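(* Consider a finite two-player zero-sum normal-form game with payoff matrix $U$. Let $\sigma^{r,n}$ be any reference strategy profile and $\mu>0$ any RT-term weight. Let $(\sigma^{t,n})_{t\ge 1}$ be the sequence of strategy profiles produced by an RTRM algorithm (any of the variants RTRM, RTRM+, RTDRM) on the $n$-th SCCP, and let $\sigma^{*,n}$ be the saddle point of the $n$-th SCCP. Then there is a constant $C>0$, depending on $\mu$, $\sigma^{r,n}$ and the game, such that for every $T\ge 1$ there exists $t$ with $0<t\le T$ and $$\|\sigma^{*,n}-\sigma^{t,n}\|_2\le \frac{C}{\sqrt{T}}.$$
   Context: Game. Player $i\in\{1,2\}$ has a finite action set $A_i$ and strategy set $\Sigma_i=\Delta^{|A_i|}$ (the probability simplex); $-i$ denotes the opponent. $U\in\mathbb{R}^{|A_1|\times|A_2|}$ is player 1's payoff matrix; $U_1=U$, and $U_2=-U^\top$ acts on player 1's strategies. A strategy profile is $\sigma=(\sigma_1,\sigma_2)\in\Sigma=\Sigma_1\times\Sigma_2$, regarded as a concatenated vector for inner products and norms. SCCP. For a reference profile $\sigma^{r,n}=(\sigma_1^{r,n},\sigma_2^{r,n})\in\Sigma$ and a weight $\mu>0$, the $n$-th strongly convex-concave problem (SCCP) is $$\min_{\sigma_1\in\Sigma_1}\max_{\sigma_2\in\Sigma_2}\ \langle\sigma_1,-U\sigma_2\rangle+\frac{\mu}{2}\|\sigma_1-\sigma_1^{r,n}\|_2^2-\frac{\mu}{2}\|\sigma_2-\sigma_2^{r,n}\|_2^2 .$$ Its (unique) saddle point is $\sigma^{*,n}=(\sigma^{*,n}_1,\sigma^{*,n}_2)$.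 RTRM dynamics (reward-transformed regret matching) on the $n$-th SCCP. At iteration $t\ge1$ each player $i$ computes $$\ell_i^{t,n}=-U_i\sigma_{-i}^{t,n}+\mu(\sigma_i^{t,n}-\sigma_i^{r,n}),\qquad r_i^{t,n}=\langle \ell_i^{t,n},\sigma_i^{t,n}\rangle\mathbf 1-\ell_i^{t,n},$$ and updates the cumulative regret vector $R_i$ by one of the following rules. - RTRM: $R_i^{t}=R_i^{t-1}+r_i^{t,n}$. - RTRM+: $R_i^{t}=[R_i^{t-1}+r_i^{t,n}]_+$. - RTDRM (discounted, with parameters $\alpha\ge\beta$): $R_i^t=\frac{t^\alpha}{t^\alpha+1}[R_i^{t-1}+r_i^{t,n}]_++\frac{t^\beta}{t^\beta+1}[R_i^{t-1}+r_i^{t,n}]_-$. Here $[x]_+=\max(x,0)$ and $[x]_-=\min(x,0)$ coordinatewise. The next strategy is $\sigma_i^{t+1,n}=[R_i^t]_+/\|[R_i^t]_+\|_1$ if $[R_i^t]_+\ne0$, and the uniform strategy otherwise. The initial strategy $\sigma^{1,n}$ (with its associated initial cumulative regret, of which $\sigma_i^{1,n}$ is the normalized positive part, or the uniform strategy if that part is zero) is the one inherited from the previous SCCP; for the first SCCP the initial strategy is uniform and the initial cumulative regret is zero.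
   Formalization: For RTDRM the formal theorem requires α ≥ 1 besides α ≥ β (the claim fails e.g. for α = β = 0), and C may also depend on the cumulative regret inherited from the previous SCCP (independence from it fails); for zero initial regret, C depends only on μ, the reference profile and the game. *)

theory Defs
  imports "HOL-Analysis.Analysis"
begin

text \<open>
  The action sets are the finite index types \<open>'a\<close> (player 1) and \<open>'b\<close> (player 2). A profile is a
  pair in \<open>(real ^ 'a) \<times> (real ^ 'b)\<close>, whose library norm is the Euclidean norm of the concatenated
  vector.
\<close>

definition prob_simplex :: "(real ^ 'n) set" where
  "prob_simplex = {x. (\<forall>i. 0 \<le> x $ i) \<and> (\<Sum>i\<in>UNIV. x $ i) = 1}"

definition strategy_profiles :: "((real ^ 'a) \<times> (real ^ 'b)) set" where
  "strategy_profiles = prob_simplex \<times> prob_simplex"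

definition payoff1 :: "real ^ 'b ^ 'a \<Rightarrow> real ^ 'b ^ 'a" where
  "payoff1 U = U"

definition payoff2 :: "real ^ 'b ^ 'a \<Rightarrow> real ^ 'a ^ 'b" where
  "payoff2 U = - transpose U"

definition sccp_objective ::
  "real ^ 'b ^ 'a \<Rightarrow> real \<Rightarrow> (real ^ 'a) \<times> (real ^ 'b) \<Rightarrow> real ^ 'a \<Rightarrow> real ^ 'b \<Rightarrow> real" where
  "sccp_objective U \<mu> \<sigma>r x y =
     x \<bullet> (- (U *v y)) + \<mu> / 2 * (norm (x - fst \<sigma>r))\<^sup>2 - \<mu> / 2 * (norm (y - snd \<sigma>r))\<^sup>2"

definition sccp_saddle_point ::
  "real ^ 'b ^ 'a \<Rightarrow> real \<Rightarrow> (real ^ 'a) \<times> (real ^ 'b) \<Rightarrow> (real ^ 'a) \<times> (real ^ 'b) \<Rightarrow> bool" where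
  "sccp_saddle_point U \<mu> \<sigma>r s \<longleftrightarrow>
     s \<in> strategy_profiles \<and>
     (\<forall>y\<in>prob_simplex.
        sccp_objective U \<mu> \<sigma>r (fst s) y \<le> sccp_objective U \<mu> \<sigma>r (fst s) (snd s)) \<and>
     (\<forall>x\<in>prob_simplex.
        sccp_objective U \<mu> \<sigma>r (fst s) (snd s) \<le> sccp_objective U \<mu> \<sigma>r x (snd s))"

definition pos_part :: "real ^ 'n \<Rightarrow> real ^ 'n" where
  "pos_part x = (\<chi> i. max (x $ i) 0)"

text \<open>The negative part keeps its sign, so that \<open>x = pos_part x + neg_part x\<close>.\<close>

definition neg_part :: "real ^ 'n \<Rightarrow> real ^ 'n" where
  "neg_part x = (\<chi> i. min (x $ i) 0)"

definition l1_norm :: "real ^ 'n \<Rightarrow> real" where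
  "l1_norm x = (\<Sum>i\<in>UNIV. \<bar>x $ i\<bar>)"

definition regret_matching :: "real ^ 'n \<Rightarrow> real ^ 'n" where
  "regret_matching R =
     (if pos_part R \<noteq> 0 then (1 / l1_norm (pos_part R)) *\<^sub>R pos_part R
      else (\<chi> i. 1 / real CARD('n)))"

definition transformed_loss ::
  "real ^ 'm ^ 'n \<Rightarrow> real \<Rightarrow> real ^ 'n \<Rightarrow> real ^ 'n \<Rightarrow> real ^ 'm \<Rightarrow> real ^ 'n" where
  "transformed_loss V \<mu> ref own opp = - (V *v opp) + \<mu> *\<^sub>R (own - ref)"

definition instant_regret :: "real ^ 'n \<Rightarrow> real ^ 'n \<Rightarrow> real ^ 'n" where
  "instant_regret l \<sigma> = (\<chi> i. l \<bullet> \<sigma> - l $ i)"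

datatype rm_variant = RTRM | RTRM_plus | RTDRM real real

text \<open>
  For \<open>\<alpha> < 1\<close> the discount \<open>t\<^sup>\<alpha> / (t\<^sup>\<alpha> + 1)\<close> forgets past regrets too fast for the rate
  \<open>1 / sqrt T\<close>. With \<open>\<alpha> = \<beta> = 0\<close>, a single action for player 2, two actions for player 1, \<open>U = 0\<close>
  and reference strategy \<open>(3/4, 1/4)\<close>, the iterates started from zero regret stay at a positive
  distance from the saddle point. Hence \<open>1 \<le> \<alpha>\<close> is required in addition to \<open>\<beta> \<le> \<alpha>\<close>.
\<close>

primrec admissible_variant :: "rm_variant \<Rightarrow> bool" where
  "admissible_variant RTRM \<longleftrightarrow> True"
| "admissible_variant RTRM_plus \<longleftrightarrow> True"
| "admissible_variant (RTDRM \<alpha> \<beta>) \<longleftrightarrow> \<beta> \<le> \<alpha> \<and> 1 \<le> \<alpha>"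

primrec regret_update ::
  "rm_variant \<Rightarrow> nat \<Rightarrow> real ^ 'n \<Rightarrow> real ^ 'n \<Rightarrow> real ^ 'n" where
  "regret_update RTRM t R r = R + r"
| "regret_update RTRM_plus t R r = pos_part (R + r)"
| "regret_update (RTDRM \<alpha> \<beta>) t R r =
     (real t powr \<alpha> / (real t powr \<alpha> + 1)) *\<^sub>R pos_part (R + r) +
     (real t powr \<beta> / (real t powr \<beta> + 1)) *\<^sub>R neg_part (R + r)"

definition rm_profile :: "(real ^ 'a) \<times> (real ^ 'b) \<Rightarrow> (real ^ 'a) \<times> (real ^ 'b)" where
  "rm_profile R = (regret_matching (fst R), regret_matching (snd R))"

definition rtrm_step ::
  "rm_variant \<Rightarrow> real ^ 'b ^ 'a \<Rightarrow> real \<Rightarrow> (real ^ 'a) \<times> (real ^ 'b) \<Rightarrow> nat \<Rightarrow>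
   (real ^ 'a) \<times> (real ^ 'b) \<Rightarrow> (real ^ 'a) \<times> (real ^ 'b)" where
  "rtrm_step v U \<mu> \<sigma>r t R =
     (let \<sigma> = rm_profile R;
          l1 = transformed_loss (payoff1 U) \<mu> (fst \<sigma>r) (fst \<sigma>) (snd \<sigma>);
          l2 = transformed_loss (payoff2 U) \<mu> (snd \<sigma>r) (snd \<sigma>) (fst \<sigma>)
      in (regret_update v t (fst R) (instant_regret l1 (fst \<sigma>)),
          regret_update v t (snd R) (instant_regret l2 (snd \<sigma>))))"

text \<open>\<open>R0\<close> is the pair of cumulative regrets inherited from the previous problem (zero for the first).\<close>

primrec cumulative_regret ::
  "rm_variant \<Rightarrow> real ^ 'b ^ 'a \<Rightarrow> real \<Rightarrow> (real ^ 'a) \<times> (real ^ 'b) \<Rightarrow>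
   (real ^ 'a) \<times> (real ^ 'b) \<Rightarrow> nat \<Rightarrow> (real ^ 'a) \<times> (real ^ 'b)" where
  "cumulative_regret v U \<mu> \<sigma>r R0 0 = R0"
| "cumulative_regret v U \<mu> \<sigma>r R0 (Suc t) =
     rtrm_step v U \<mu> \<sigma>r (Suc t) (cumulative_regret v U \<mu> \<sigma>r R0 t)"

text \<open>The strategy profile of iteration \<open>t \<ge> 1\<close> is obtained from the regrets after iteration \<open>t - 1\<close>.\<close>

definition rtrm_iterate ::
  "rm_variant \<Rightarrow> real ^ 'b ^ 'a \<Rightarrow> real \<Rightarrow> (real ^ 'a) \<times> (real ^ 'b) \<Rightarrow>
   (real ^ 'a) \<times> (real ^ 'b) \<Rightarrow> nat \<Rightarrow> (real ^ 'a) \<times> (real ^ 'b)" where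
  "rtrm_iterate v U \<mu> \<sigma>r R0 t = rm_profile (cumulative_regret v U \<mu> \<sigma>r R0 (t - 1))"

end

(*
  Let z be the regret at the saddle point s; optimality gives z <= 0. The one-step growth of
  |[R]_+|^2 / 2, usually bounded by |r|^2 / 2, is at most a telescoping term in z plus |r - z|^2 / 2,
  which is quadratic in the distance to s. Strong monotonicity makes <r, s>, summed over both players,
  at least mu times the squared distance, so Fenchel-Young against a large multiple of s bounds the sum
  of squared distances by a constant. All variants multiply the positive part by a factor in
  [t/(t+1), 1]; weighting iteration t by the inverse product of these factors undoes the discount. The
  telescoping defect this creates is of first order in the distance, and is absorbed by
  -<sigma_t, z>, which appears with a large factor in <r, s>.
*)

theory Submission
  imports Defs
begin

section \<open>Positive parts, regret matching and instantaneous regrets\<close>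

lemma pos_part_nth [simp]: "pos_part x $ i = max (x $ i) 0"
  by (simp add: pos_part_def)

lemma neg_part_nth [simp]: "neg_part x $ i = min (x $ i) 0"
  by (simp add: neg_part_def)

lemma pos_part_add_neg_part: "pos_part x + neg_part x = x"
  by (simp add: vec_eq_iff max_def min_def)

lemma inner_nonneg_cart:
  fixes x y :: "real ^ 'n"
  assumes "\<And>i. 0 \<le> x $ i" "\<And>i. 0 \<le> y $ i"
  shows "0 \<le> x \<bullet> y"
  unfolding inner_vec_def by (intro sum_nonneg) (simp add: assms)

lemma l1_norm_pos_part: "l1_norm (pos_part x) = (\<Sum>i\<in>UNIV. max (x $ i) 0)"
  by (simp add: l1_norm_def)

lemma l1_norm_le_norm:
  fixes x :: "real ^ 'n"
  shows "l1_norm x \<le> real CARD('n) * norm x"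
  unfolding l1_norm_def
  using sum_bounded_above[of UNIV "\<lambda>i. \<bar>x $ i\<bar>" "norm x"] component_le_norm_cart[of x] by simp

lemma norm_prob_simplex_le:
  assumes "x \<in> prob_simplex"
  shows "norm x \<le> 1"
  using norm_le_l1_cart[of x] assms by (simp add: prob_simplex_def)

text \<open>If the positive part vanishes, so does the scalar, and the uniform fallback does no
  harm. This replaces case distinctions on the strategy later.\<close>

lemma pos_part_eq_scaleR_regret_matching:
  "pos_part R = l1_norm (pos_part R) *\<^sub>R regret_matching R"
proof (cases "pos_part R = 0")
  case False
  then have "l1_norm (pos_part R) \<noteq> 0"
    unfolding l1_norm_def by (subst sum_nonneg_eq_0_iff) (auto simp: vec_eq_iff)
  with False show ?thesis by (simp add: regret_matching_def)
qed (simp add: l1_norm_def)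

lemma regret_matching_in_prob_simplex: "regret_matching R \<in> prob_simplex"
proof (cases "pos_part R = 0")
  case True
  then show ?thesis by (simp add: regret_matching_def prob_simplex_def)
next
  case False
  then have "l1_norm (pos_part R) \<noteq> 0"
    unfolding l1_norm_def by (subst sum_nonneg_eq_0_iff) (auto simp: vec_eq_iff)
  moreover have "0 \<le> l1_norm (pos_part R)"
    by (simp add: l1_norm_def sum_nonneg)
  ultimately show ?thesis using False
    by (simp add: regret_matching_def prob_simplex_def l1_norm_pos_part
        flip: sum_divide_distrib)
qed

lemma inner_instant_regret:
  assumes "x \<in> prob_simplex"
  shows "instant_regret l \<sigma> \<bullet> x = l \<bullet> (\<sigma> - x)"
proof -
  have "instant_regret l \<sigma> \<bullet> x = (l \<bullet> \<sigma>) * (\<Sum>i\<in>UNIV. x $ i) - l \<bullet> x"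
    by (simp add: instant_regret_def inner_vec_def left_diff_distrib sum_subtractf sum_distrib_left)
  with assms show ?thesis by (simp add: prob_simplex_def inner_diff_right)
qed

text \<open>Blackwell's condition: the positive regret is a multiple of the strategy played, and a
  strategy has no regret against itself. It removes the term \<open>pos_part x \<bullet> r\<close>
  from the growth of the potential.\<close>

lemma pos_part_inner_instant_regret:
  "pos_part R \<bullet> instant_regret l (regret_matching R) = 0"
  by (subst pos_part_eq_scaleR_regret_matching)
    (simp add: inner_commute[of "regret_matching R"] inner_instant_regret
      regret_matching_in_prob_simplex)

section \<open>The weighted regret potential\<close>

text \<open>With \<open>p\<close> and \<open>q\<close> the positive parts of \<open>x\<close> and
  \<open>x + r\<close>, split \<open>(q - p) * r\<close> into \<open>(q - p) * z\<close> and
  \<open>(q - p) * (r - z)\<close>. Young's inequality bounds the second product by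
  \<open>(r - z)\<^sup>2 / 2 + (q - p)\<^sup>2 / 2\<close>, and strong convexity of the square
  absorbs the last summand.\<close>

lemma half_square_pos_part_add_le:
  fixes x r z :: real
  shows "(max (x + r) 0)\<^sup>2 / 2 \<le> (max x 0)\<^sup>2 / 2 + max x 0 * r
    + (max (x + r) 0 - max x 0) * z + (r - z)\<^sup>2 / 2"
proof -
  define p q where "p = max x 0" and "q = max (x + r) 0"
  have "q * (q - p - r) \<le> 0"
    by (cases "x + r \<le> 0") (auto simp: p_def q_def mult_le_0_iff)
  moreover have "0 \<le> (r - z - (q - p))\<^sup>2" by simp
  ultimately have "q\<^sup>2 / 2 \<le> p\<^sup>2 / 2 + p * r + (q - p) * z + (r - z)\<^sup>2 / 2"
    by (simp add: power2_eq_square field_simps)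
  then show ?thesis by (simp add: p_def q_def)
qed

text \<open>
  The last two summands replace the usual error \<open>(norm r)\<^sup>2 / 2\<close>: for \<open>z\<close> the regret at the saddle point,
  the first telescopes and the second is quadratic in the distance to the saddle point.
\<close>

lemma half_norm_pos_part_add_le:
  fixes x r z :: "real ^ 'n"
  shows "(norm (pos_part (x + r)))\<^sup>2 / 2 \<le> (norm (pos_part x))\<^sup>2 / 2 + pos_part x \<bullet> r
    + (pos_part (x + r) - pos_part x) \<bullet> z + (norm (r - z))\<^sup>2 / 2"
proof -
  have "(\<Sum>i\<in>UNIV. (max (x $ i + r $ i) 0)\<^sup>2 / 2) \<le> (\<Sum>i\<in>UNIV. (max (x $ i) 0)\<^sup>2 / 2 + max (x $ i) 0 * r $ i
    + (max (x $ i + r $ i) 0 - max (x $ i) 0) * z $ i + (r $ i - z $ i)\<^sup>2 / 2)"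
    by (intro sum_mono half_square_pos_part_add_le)
  then show ?thesis
    unfolding power2_norm_eq_inner
    by (simp add: inner_vec_def sum.distrib sum_divide_distrib power2_eq_square)
qed

lemma l1_norm_pos_part_add_le:
  "l1_norm (pos_part (x + r)) \<le> l1_norm (pos_part x) + l1_norm r"
  unfolding l1_norm_pos_part unfolding l1_norm_def sum.distrib[symmetric]
  by (intro sum_mono) auto

text \<open>The potential argument for one player, with abstract factors so that it serves both
  players and every variant. \<open>lam\<close> is the multiple of the comparator \<open>s\<close>
  to which Fenchel-Young is applied; \<open>M\<close> is the growth rate of the positive
  regret.\<close>

lemma discounted_potential_bound:
  fixes R r :: "nat \<Rightarrow> real ^ 'n" and a b w :: "nat \<Rightarrow> real"
  assumes upd: "\<And>t. R (Suc t) = a (Suc t) *\<^sub>R pos_part (R t + r t) + b (Suc t) *\<^sub>R neg_part (R t + r t)"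
    and orth: "\<And>t. pos_part (R t) \<bullet> r t = 0"
    and a_ge: "\<And>t. real t / (real t + 1) \<le> a t" and a_le: "\<And>t. a t \<le> 1"
    and b_ge: "\<And>t. 0 \<le> b t" and b_le: "\<And>t. b t \<le> a t"
    and w0: "w 0 = 1" and w_Suc: "\<And>t. w (Suc t) * a (Suc t) = w t" and w_pos: "\<And>t. 0 < w t"
    and z: "\<And>i. z $ i \<le> 0" and s: "\<And>i. 0 \<le> s $ i" and lam: "0 \<le> lam"
    and M: "\<And>t. l1_norm (pos_part (R t)) \<le> M * (real t + 1)"
  shows "(\<Sum>t<T. w t * (lam * (r t \<bullet> s) + M * w t * (regret_matching (R t) \<bullet> z)
            - w t * (norm (r t - z))\<^sup>2 / 2))
    \<le> (norm (pos_part (R 0)))\<^sup>2 / 2 - lam * (R 0 \<bullet> s) - pos_part (R 0) \<bullet> z + lam\<^sup>2 * (norm s)\<^sup>2 / 2"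
proof -
  define P where "P t = pos_part (R t)" for t
  define Q where "Q t = pos_part (R t + r t)" for t
  \<comment> \<open>The last summand is the boundary term of the telescoping sum in
    \<open>z\<close>. It carries \<open>a t\<close> because
    \<open>a (Suc t) * (w (Suc t))\<^sup>2\<close> times \<open>P (Suc t)\<close> equals
    \<open>(w t)\<^sup>2\<close> times \<open>Q t\<close>.\<close>
  define G where "G t = (w t)\<^sup>2 * (norm (P t))\<^sup>2 / 2 - lam * w t * (R t \<bullet> s) - a t * (w t)\<^sup>2 * (P t \<bullet> z)" for t
  define g where "g t = w t * (lam * (r t \<bullet> s) + M * w t * (regret_matching (R t) \<bullet> z)
            - w t * (norm (r t - z))\<^sup>2 / 2)" for t
  have a0: "0 \<le> a t" for t
    using a_ge[of t] by (meson divide_nonneg_nonneg of_nat_0_le_iff order_trans add_nonneg_nonneg zero_le_one)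
  have Pz: "P t \<bullet> z \<le> 0" for t
    using inner_nonneg_cart[of "P t" "- z"] z by (auto simp: P_def)
  have step: "G (Suc t) + g t \<le> G t" for t
  proof -
    have PQ: "P (Suc t) = a (Suc t) *\<^sub>R Q t"
    proof -
      have "max (a (Suc t) * max x 0 + b (Suc t) * min x 0) 0 = a (Suc t) * max x 0" for x :: real
        using a0[of "Suc t"] b_ge[of "Suc t"]
        by (cases "x \<le> 0") (simp_all add: max_absorb1 max_absorb2 mult_nonneg_nonpos)
      then show ?thesis by (simp add: vec_eq_iff P_def Q_def upd)
    qed
    have wP: "w (Suc t) *\<^sub>R P (Suc t) = w t *\<^sub>R Q t"
      by (simp add: PQ w_Suc)
    have sq: "(w (Suc t))\<^sup>2 * (norm (P (Suc t)))\<^sup>2 = (w t)\<^sup>2 * (norm (Q t))\<^sup>2"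
      using arg_cong[OF wP, of "\<lambda>v. (norm v)\<^sup>2"] by (simp add: power_mult_distrib)
    have az: "a (Suc t) * (w (Suc t))\<^sup>2 * (P (Suc t) \<bullet> z) = (w t)\<^sup>2 * (Q t \<bullet> z)"
      using arg_cong[OF wP, of "\<lambda>v. v \<bullet> z"] w_Suc[of t]
      by (simp add: power2_eq_square) (metis mult.assoc mult.commute)
    \<comment> \<open>Negative parts pair nonpositively with \<open>s\<close>, and
      \<open>b \<le> a\<close> shrinks them at least as much as the common factor \<open>a\<close>
      would.\<close>
    have "a (Suc t) * ((R t + r t) \<bullet> s) \<le> R (Suc t) \<bullet> s"
    proof -
      have "0 \<le> (- neg_part (R t + r t)) \<bullet> s"
        by (rule inner_nonneg_cart) (auto simp: s)
      then have "0 \<le> (a (Suc t) - b (Suc t)) * ((- neg_part (R t + r t)) \<bullet> s)"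
        using b_le[of "Suc t"] by (intro mult_nonneg_nonneg) auto
      moreover have "(R t + r t) \<bullet> s = pos_part (R t + r t) \<bullet> s + neg_part (R t + r t) \<bullet> s"
        by (metis pos_part_add_neg_part inner_add_left)
      ultimately show ?thesis
        by (simp add: upd inner_add_left algebra_simps)
    qed
    then have "w (Suc t) * (a (Suc t) * ((R t + r t) \<bullet> s)) \<le> w (Suc t) * (R (Suc t) \<bullet> s)"
      using w_pos[of "Suc t"] by simp
    then have "w t * ((R t + r t) \<bullet> s) \<le> w (Suc t) * (R (Suc t) \<bullet> s)"
      by (simp add: w_Suc mult.assoc[symmetric])
    then have lin: "lam * w t * (R t \<bullet> s) + lam * w t * (r t \<bullet> s) \<le> lam * w (Suc t) * (R (Suc t) \<bullet> s)"
      using mult_left_mono[OF _ lam] by (fastforce simp: inner_add_left algebra_simps)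
    have "(norm (Q t))\<^sup>2 / 2 \<le> (norm (P t))\<^sup>2 / 2 + Q t \<bullet> z - P t \<bullet> z + (norm (r t - z))\<^sup>2 / 2"
      using half_norm_pos_part_add_le[of "R t" "r t" z] orth[of t]
      by (simp add: P_def Q_def inner_diff_left)
    from mult_left_mono[OF this, of "(w t)\<^sup>2"]
    have quad: "(w t)\<^sup>2 * (norm (Q t))\<^sup>2 / 2 \<le> (w t)\<^sup>2 * (norm (P t))\<^sup>2 / 2 + (w t)\<^sup>2 * (Q t \<bullet> z)
      - (w t)\<^sup>2 * (P t \<bullet> z) + (w t)\<^sup>2 * (norm (r t - z))\<^sup>2 / 2"
      by (simp add: algebra_simps)
    \<comment> \<open>The telescoping defect has coefficient
      \<open>1 - a t \<le> 1 / (t + 1)\<close>, while the positive regret is at most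
      \<open>M * (t + 1)\<close> times the strategy: growth and decay cancel.\<close>
    have disc: "M * (regret_matching (R t) \<bullet> z) \<le> (1 - a t) * (P t \<bullet> z)"
    proof -
      have rz: "regret_matching (R t) \<bullet> z \<le> 0"
        using inner_nonneg_cart[of "regret_matching (R t)" "- z"] z
          regret_matching_in_prob_simplex[of "R t"] by (auto simp: prob_simplex_def)
      have "(1 - a t) * l1_norm (P t) \<le> (1 / (real t + 1)) * (M * (real t + 1))"
        using a_ge[of t] a_le[of t] M[of t]
        by (intro mult_mono) (auto simp: P_def l1_norm_def sum_nonneg field_simps)
      then have "(1 - a t) * l1_norm (P t) \<le> M" by simp
      from mult_right_mono_neg[OF this rz] show ?thesis
        using pos_part_eq_scaleR_regret_matching[of "R t"]
        by (metis P_def inner_scaleR_left mult.assoc)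
    qed
    from mult_left_mono[OF this, of "(w t)\<^sup>2"]
    have "(w t)\<^sup>2 * (M * (regret_matching (R t) \<bullet> z)) \<le> (w t)\<^sup>2 * (P t \<bullet> z) - a t * (w t)\<^sup>2 * (P t \<bullet> z)"
      by (simp add: algebra_simps)
    then show ?thesis
      using lin quad sq az unfolding G_def g_def
      by (simp add: algebra_simps power2_eq_square)
  qed
  have "G T + (\<Sum>t<T. g t) \<le> G 0"
  proof (induction T)
    case (Suc T)
    then show ?case using step[of T] by simp
  qed simp
  \<comment> \<open>Fenchel-Young by completing a square. Negative regrets and the boundary term
    only raise \<open>G T\<close>, by the signs of \<open>s\<close> and \<open>z\<close>.\<close>
  moreover have "- (lam\<^sup>2 * (norm s)\<^sup>2 / 2) \<le> G T"
  proof -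
    have "R T \<bullet> s \<le> P T \<bullet> s"
      using inner_nonneg_cart[of "P T - R T" s] s by (auto simp: P_def inner_diff_left)
    then have "lam * w T * (R T \<bullet> s) \<le> lam * w T * (P T \<bullet> s)"
      using w_pos[of T] lam by (intro mult_left_mono) auto
    moreover have "0 \<le> (norm (w T *\<^sub>R P T - lam *\<^sub>R s))\<^sup>2" by simp
    then have "0 \<le> (w T)\<^sup>2 * (norm (P T))\<^sup>2 - 2 * (lam * w T * (P T \<bullet> s)) + lam\<^sup>2 * (norm s)\<^sup>2"
      unfolding power2_norm_eq_inner
      by (simp add: inner_diff_left inner_diff_right inner_commute power2_eq_square algebra_simps)
    moreover have "a T * (w T)\<^sup>2 * (P T \<bullet> z) \<le> 0"
      using a0[of T] Pz[of T] by (intro mult_nonneg_nonpos) auto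
    ultimately show ?thesis unfolding G_def by linarith
  qed
  moreover have "G 0 \<le> (norm (P 0))\<^sup>2 / 2 - lam * (R 0 \<bullet> s) - P 0 \<bullet> z"
    using mult_right_mono_neg[OF a_le[of 0] Pz[of 0]] by (simp add: G_def w0)
  ultimately show ?thesis
    by (simp add: g_def P_def)
qed

section \<open>Optimality at the saddle point\<close>

text \<open>The transformed loss at \<open>s\<close> is the gradient of the regularized objective
  there, so positive regret at \<open>i\<close> would make the direction towards the vertex
  \<open>axis i 1\<close> a descent direction.\<close>

lemma transformed_loss_optimality:
  fixes V :: "real ^ 'm ^ 'n"
  assumes mu: "0 < \<mu>" and s: "s \<in> prob_simplex"
    and opt: "\<And>x. x \<in> prob_simplex \<Longrightarrow>
      s \<bullet> (- (V *v opp)) + \<mu> / 2 * (norm (s - ref))\<^sup>2 \<le> x \<bullet> (- (V *v opp)) + \<mu> / 2 * (norm (x - ref))\<^sup>2"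
  shows "instant_regret (transformed_loss V \<mu> ref s opp) s $ i \<le> 0"
proof (rule ccontr)
  define l where "l = transformed_loss V \<mu> ref s opp"
  \<comment> \<open>\<open>e\<close> is the regret at \<open>i\<close>, the rate of descent along
    \<open>d\<close>, and \<open>k\<close> the curvature: a step \<open>h\<close> changes the
    objective by \<open>h\<^sup>2 * k - h * e\<close>.\<close>
  define d where "d = axis i 1 - s"
  define e where "e = - (l \<bullet> d)"
  define k where "k = \<mu> / 2 * (norm d)\<^sup>2"
  assume "\<not> ?thesis"
  then have e: "0 < e"
    by (simp add: instant_regret_def l_def e_def d_def inner_diff_right inner_axis)
  have k: "0 \<le> k" using mu by (simp add: k_def)
  have ineq: "h * e \<le> h\<^sup>2 * k" if h: "0 \<le> h" "h \<le> 1" for h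
  proof -
    have "s + h *\<^sub>R d \<in> prob_simplex"
    proof -
      have "(s + h *\<^sub>R d) $ j = (1 - h) * s $ j + h * axis i 1 $ j" for j
        by (simp add: d_def algebra_simps)
      moreover have "(\<Sum>j\<in>UNIV. axis i (1::real) $ j) = 1"
        by (simp add: axis_def)
      ultimately show ?thesis using s h
        by (simp add: prob_simplex_def sum.distrib flip: sum_distrib_left)
          (simp add: axis_def)
    qed
    from opt[OF this] show ?thesis
      unfolding power2_norm_eq_inner k_def e_def l_def transformed_loss_def
      by (simp add: inner_simps inner_commute power2_eq_square algebra_simps)
  qed
  \<comment> \<open>The cap 1 keeps the step inside the simplex; the other bound forces
    \<open>h * k < e\<close>, against \<open>ineq\<close>.\<close>
  define h where "h = min 1 (e / (2 * k + 1))"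
  have "h \<le> e / (2 * k + 1)" by (simp add: h_def)
  then have "h * (2 * k + 1) \<le> e"
    using k by (simp add: pos_le_divide_eq)
  moreover have "0 < h" "h \<le> 1"
    using e k by (simp_all add: h_def)
  ultimately have h: "0 < h" "h \<le> 1" "h * (2 * k + 1) \<le> e" by auto
  have "e \<le> h * k"
    using ineq[of h] h(1,2) by (simp add: power2_eq_square)
  moreover have "0 \<le> h * k" using h(1) k by simp
  ultimately show False using h e by (simp add: algebra_simps)
qed

lemma payoff2_mult: "payoff2 U *v x = - (x v* U)"
  using matrix_vector_mult_diff_rdistrib[of 0 "transpose U" x] by (simp add: payoff2_def)

lemma saddle_point_instant_regret_nonpos:
  fixes U :: "real ^ 'b ^ 'a"
  assumes mu: "0 < \<mu>" and sad: "sccp_saddle_point U \<mu> \<sigma>r \<sigma>s"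
  shows "instant_regret (transformed_loss (payoff1 U) \<mu> (fst \<sigma>r) (fst \<sigma>s) (snd \<sigma>s)) (fst \<sigma>s) $ i \<le> 0"
    and "instant_regret (transformed_loss (payoff2 U) \<mu> (snd \<sigma>r) (snd \<sigma>s) (fst \<sigma>s)) (snd \<sigma>s) $ j \<le> 0"
proof -
  have mem: "fst \<sigma>s \<in> prob_simplex" "snd \<sigma>s \<in> prob_simplex"
    using sad by (auto simp: sccp_saddle_point_def strategy_profiles_def)
  show "instant_regret (transformed_loss (payoff1 U) \<mu> (fst \<sigma>r) (fst \<sigma>s) (snd \<sigma>s)) (fst \<sigma>s) $ i \<le> 0"
    using sad
    by (intro transformed_loss_optimality mu mem)
      (simp add: sccp_saddle_point_def sccp_objective_def payoff1_def)
  \<comment> \<open>In terms of \<open>payoff2\<close> the maximization by player 2 becomes a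
    minimization of the form used for player 1; the regularizer of player 1 cancels.\<close>
  have flip: "y \<bullet> (- (payoff2 U *v x)) = x \<bullet> (U *v y)" for x y
    by (metis payoff2_mult minus_minus inner_commute dot_lmul_matrix)
  show "instant_regret (transformed_loss (payoff2 U) \<mu> (snd \<sigma>r) (snd \<sigma>s) (fst \<sigma>s)) (snd \<sigma>s) $ j \<le> 0"
  proof (intro transformed_loss_optimality mu mem)
    fix y :: "real ^ 'b"
    assume "y \<in> prob_simplex"
    with sad have "sccp_objective U \<mu> \<sigma>r (fst \<sigma>s) y \<le> sccp_objective U \<mu> \<sigma>r (fst \<sigma>s) (snd \<sigma>s)"
      by (simp add: sccp_saddle_point_def)
    then show "snd \<sigma>s \<bullet> (- (payoff2 U *v fst \<sigma>s)) + \<mu> / 2 * (norm (snd \<sigma>s - snd \<sigma>r))\<^sup>2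
        \<le> y \<bullet> (- (payoff2 U *v fst \<sigma>s)) + \<mu> / 2 * (norm (y - snd \<sigma>r))\<^sup>2"
      unfolding flip sccp_objective_def by simp
  qed
qed

section \<open>Lipschitz continuity and strong monotonicity of the regrets\<close>

text \<open>The regret contains the product of loss and strategy. It is split so that the loss
  difference meets the bounded \<open>x\<close> and the strategy difference meets the loss at the
  fixed base point, on which the constant may depend.\<close>

lemma instant_regret_lipschitz:
  fixes V :: "real ^ 'm ^ 'n"
  assumes "0 < \<mu>"
  shows "\<exists>L\<ge>0. \<forall>x\<in>prob_simplex. \<forall>y.
    norm (instant_regret (transformed_loss V \<mu> ref x y) x
        - instant_regret (transformed_loss V \<mu> ref x0 y0) x0)
      \<le> L * (norm (x - x0) + norm (y - y0))"
proof -
  define N where "N = norm ((\<chi> i. 1) :: real ^ 'n)"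
  define l0 where "l0 = transformed_loss V \<mu> ref x0 y0"
  define B where "B = onorm ((*v) V) + \<mu>"
  have on: "0 \<le> onorm ((*v) V)"
    by (rule onorm_pos_le) (rule matrix_vector_mul_bounded_linear)
  have nonneg: "0 \<le> B" "0 \<le> N"
    using on assms by (auto simp: B_def N_def)
  have "norm (instant_regret (transformed_loss V \<mu> ref x y) x - instant_regret l0 x0)
      \<le> ((B + norm l0) * N + B) * (norm (x - x0) + norm (y - y0))"
    if x: "x \<in> prob_simplex" for x y
  proof -
    define l where "l = transformed_loss V \<mu> ref x y"
    define S where "S = norm (x - x0) + norm (y - y0)"
    have "l - l0 = - (V *v (y - y0)) + \<mu> *\<^sub>R (x - x0)"
      by (simp add: l_def l0_def transformed_loss_def algebra_simps)
    then have "norm (l - l0) \<le> norm (V *v (y - y0)) + \<mu> * norm (x - x0)"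
      using norm_triangle_ineq[of "- (V *v (y - y0))" "\<mu> *\<^sub>R (x - x0)"] assms by simp
    also have "\<dots> \<le> onorm ((*v) V) * norm (y - y0) + \<mu> * norm (x - x0)"
      using onorm[OF matrix_vector_mul_bounded_linear, of V "y - y0"] by simp
    also have "\<dots> \<le> B * S"
      using on assms by (simp add: B_def S_def algebra_simps)
    finally have ll: "norm (l - l0) \<le> B * S" .
    have "l \<bullet> x - l0 \<bullet> x0 = (l - l0) \<bullet> x + l0 \<bullet> (x - x0)"
      by (simp add: inner_diff_left inner_diff_right)
    then have "\<bar>l \<bullet> x - l0 \<bullet> x0\<bar> \<le> norm (l - l0) * norm x + norm l0 * norm (x - x0)"
      using Cauchy_Schwarz_ineq2[of "l - l0" x] Cauchy_Schwarz_ineq2[of l0 "x - x0"] by linarith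
    also have "norm (l - l0) * norm x \<le> B * S * 1"
      using ll norm_prob_simplex_le[OF x] by (intro mult_mono) (auto simp: nonneg S_def)
    also have "norm l0 * norm (x - x0) \<le> norm l0 * S"
      by (intro mult_left_mono) (auto simp: S_def)
    finally have lx: "\<bar>l \<bullet> x - l0 \<bullet> x0\<bar> \<le> (B + norm l0) * S"
      by (simp add: algebra_simps)
    have "instant_regret l x - instant_regret l0 x0
        = (l \<bullet> x - l0 \<bullet> x0) *\<^sub>R (\<chi> i. 1) - (l - l0)"
      by (simp add: instant_regret_def vec_eq_iff)
    then have "norm (instant_regret l x - instant_regret l0 x0) \<le> \<bar>l \<bullet> x - l0 \<bullet> x0\<bar> * N + norm (l - l0)"
      using norm_triangle_ineq4[of "(l \<bullet> x - l0 \<bullet> x0) *\<^sub>R ((\<chi> i. 1) :: real ^ 'n)" "l - l0"]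
      by (simp add: N_def)
    also have "\<dots> \<le> ((B + norm l0) * S) * N + B * S"
      using lx ll nonneg by (intro add_mono mult_right_mono) auto
    finally show ?thesis by (simp add: l_def S_def algebra_simps)
  qed
  moreover have "0 \<le> (B + norm l0) * N + B" using nonneg by simp
  ultimately show ?thesis unfolding l0_def by blast
qed

text \<open>The coupling through \<open>U\<close> is skew, so only the regularizer contributes to the quadratic term.\<close>

lemma instant_regret_inner_sum:
  fixes U :: "real ^ 'b ^ 'a" and ref1 :: "real ^ 'a" and ref2 :: "real ^ 'b" and \<mu> :: real
  defines "reg1 \<equiv> (\<lambda>x y. instant_regret (transformed_loss (payoff1 U) \<mu> ref1 x y) x)"
    and "reg2 \<equiv> (\<lambda>x y. instant_regret (transformed_loss (payoff2 U) \<mu> ref2 y x) y)"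
  assumes "x \<in> prob_simplex" "y \<in> prob_simplex" "x' \<in> prob_simplex" "y' \<in> prob_simplex"
  shows "reg1 x y \<bullet> x' + reg2 x y \<bullet> y'
    = - (x \<bullet> reg1 x' y') - y \<bullet> reg2 x' y' + \<mu> * ((norm (x - x'))\<^sup>2 + (norm (y - y'))\<^sup>2)"
proof -
  have comm: "(U *v v) \<bullet> u = u \<bullet> (U *v v)" for u v
    by (rule inner_commute)
  show ?thesis
    unfolding reg1_def reg2_def
    by (subst (1 2) inner_commute[of _ "instant_regret _ _"])
      (simp add: inner_instant_regret assms transformed_loss_def payoff1_def payoff2_mult
        power2_norm_eq_inner inner_simps dot_lmul_matrix comm algebra_simps inner_commute[of x' x]
        inner_commute[of y' y] inner_commute[of ref1] inner_commute[of ref2])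
qed

section \<open>Discount factors and weights\<close>

text \<open>Factors on the positive and the negative part put all three update rules into one form;
  for RTRM+ the negative factor is 0.\<close>

primrec pos_discount :: "rm_variant \<Rightarrow> nat \<Rightarrow> real" where
  "pos_discount RTRM t = 1"
| "pos_discount RTRM_plus t = 1"
| "pos_discount (RTDRM \<alpha> \<beta>) t = real t powr \<alpha> / (real t powr \<alpha> + 1)"

primrec neg_discount :: "rm_variant \<Rightarrow> nat \<Rightarrow> real" where
  "neg_discount RTRM t = 1"
| "neg_discount RTRM_plus t = 0"
| "neg_discount (RTDRM \<alpha> \<beta>) t = real t powr \<beta> / (real t powr \<beta> + 1)"

lemma regret_update_eq:
  "regret_update v t R r
    = pos_discount v t *\<^sub>R pos_part (R + r) + neg_discount v t *\<^sub>R neg_part (R + r)"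
  by (cases v) (simp_all add: pos_part_add_neg_part)

lemma divide_add_one_mono:
  fixes x y :: real
  assumes "0 \<le> x" "x \<le> y"
  shows "x / (x + 1) \<le> y / (y + 1)"
  using assms by (simp add: field_simps)

text \<open>For the discounted rule, \<open>x / (x + 1)\<close> is increasing and
  \<open>1 \<le> \<alpha>\<close> gives \<open>t \<le> t powr \<alpha>\<close>. At
  \<open>t = 0\<close> both of its factors are 0, since \<open>0 powr \<alpha>\<close> is 0.\<close>

lemma discount_bounds:
  assumes "admissible_variant v"
  shows "real t / (real t + 1) \<le> pos_discount v t" "pos_discount v t \<le> 1"
    and "0 \<le> neg_discount v t" "neg_discount v t \<le> pos_discount v t"
proof -
  show "real t / (real t + 1) \<le> pos_discount v t"
  proof (cases v)
    case (RTDRM \<alpha> \<beta>)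
    then have "real t \<le> real t powr \<alpha>"
      using assms powr_mono[of 1 \<alpha> "real t"] by (cases "t = 0") auto
    with RTDRM show ?thesis by (simp add: divide_add_one_mono)
  qed auto
  show "neg_discount v t \<le> pos_discount v t"
  proof (cases v)
    case (RTDRM \<alpha> \<beta>)
    then have "real t powr \<beta> \<le> real t powr \<alpha>"
      using assms powr_mono[of \<beta> \<alpha> "real t"] by (cases "t = 0") auto
    with RTDRM show ?thesis by (simp add: divide_add_one_mono)
  qed auto
  show "pos_discount v t \<le> 1"
    by (cases v) (auto simp: divide_le_eq_1 intro: add_nonneg_pos)
  show "0 \<le> neg_discount v t"
    by (cases v) auto
qed

text \<open>Source of the linear growth assumed as \<open>M\<close> in
  \<open>discounted_potential_bound\<close>: discounting does not enlarge the positive part, and the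
  negative part adds nothing to it.\<close>

lemma l1_norm_pos_part_regret_update_le:
  assumes "admissible_variant v"
  shows "l1_norm (pos_part (regret_update v t R r)) \<le> l1_norm (pos_part R) + l1_norm r"
proof -
  have "max (pos_discount v t * max x 0 + neg_discount v t * min x 0) 0 \<le> max x 0" for x
  proof -
    have "pos_discount v t * max x 0 \<le> max x 0"
      using discount_bounds(2)[OF assms, of t] mult_right_mono[of "pos_discount v t" 1 "max x 0"] by simp
    moreover have "neg_discount v t * min x 0 \<le> 0"
      using discount_bounds(3)[OF assms, of t] by (simp add: mult_nonneg_nonpos)
    ultimately show ?thesis by simp
  qed
  then have "l1_norm (pos_part (regret_update v t R r)) \<le> l1_norm (pos_part (R + r))"
    unfolding l1_norm_pos_part regret_update_eq by (intro sum_mono) simp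
  with l1_norm_pos_part_add_le[of R r] show ?thesis by linarith
qed

text \<open>
  Multiplying the cumulative regrets by these weights turns the discounted sum into an ordinary
  weighted sum. The growth condition \<open>1 \<le> \<alpha>\<close> keeps the weights at most linear in \<open>t\<close>.
\<close>

definition discount_weight :: "rm_variant \<Rightarrow> nat \<Rightarrow> real" where
  "discount_weight v t = inverse (\<Prod>k<t. pos_discount v (Suc k))"

lemma pos_discount_Suc_pos:
  assumes "admissible_variant v"
  shows "0 < pos_discount v (Suc t)"
  by (rule less_le_trans[OF _ discount_bounds(1)[OF assms]]) simp

lemma discount_weight_pos:
  assumes "admissible_variant v"
  shows "0 < discount_weight v t"
  by (simp add: discount_weight_def prod_pos pos_discount_Suc_pos[OF assms])

lemma discount_weight_Suc:
  assumes "admissible_variant v"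
  shows "discount_weight v (Suc t) * pos_discount v (Suc t) = discount_weight v t"
  using pos_discount_Suc_pos[OF assms, of t] by (simp add: discount_weight_def)

lemma discount_weight_mono:
  assumes "admissible_variant v" "t \<le> T"
  shows "discount_weight v t \<le> discount_weight v T"
  using assms(2)
proof (rule lift_Suc_mono_le[rotated])
  show "discount_weight v n \<le> discount_weight v (Suc n)" for n
    using discount_weight_Suc[OF assms(1), of n] discount_bounds(2)[OF assms(1), of "Suc n"]
      discount_weight_pos[OF assms(1), of "Suc n"]
    by (metis less_eq_real_def mult_left_le)
qed

text \<open>Since a factor is at least \<open>t / (t + 1)\<close>, raising \<open>T\<close> by one
  raises the left side by at most the new weight. The total weight is thus comparable to
  \<open>T\<close> times the largest one, which preserves the rate.\<close>

lemma sum_discount_weight_ge: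
  assumes "admissible_variant v"
  shows "discount_weight v T * real T / 2 \<le> (\<Sum>t<T. discount_weight v t)"
proof (induction T)
  case (Suc T)
  let ?w = "discount_weight v"
  have "?w (Suc T) * (real (Suc T) / (real (Suc T) + 1)) \<le> ?w T"
    using discount_weight_Suc[OF assms, of T] discount_bounds(1)[OF assms, of "Suc T"]
      discount_weight_pos[OF assms, of "Suc T"]
    by (metis less_eq_real_def mult_left_mono)
  then have "?w (Suc T) * real (Suc T) / 2 \<le> ?w T * real T / 2 + ?w T"
    by (simp add: field_simps)
  with Suc show ?case by simp
qed simp

section \<open>The best-iterate rate\<close>

theorem theorem1:
  fixes U :: "real ^ 'b ^ 'a"
    and \<mu> :: real
    and \<sigma>r \<sigma>s R0 :: "(real ^ 'a) \<times> (real ^ 'b)"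
  assumes "0 < \<mu>"
    and "\<sigma>r \<in> strategy_profiles"
    and "sccp_saddle_point U \<mu> \<sigma>r \<sigma>s"
  shows "\<exists>C>0. \<forall>v. admissible_variant v \<longrightarrow>
           (\<forall>T::nat. 1 \<le> T \<longrightarrow>
              (\<exists>t. 0 < t \<and> t \<le> T \<and>
                 norm (\<sigma>s - rtrm_iterate v U \<mu> \<sigma>r R0 t) \<le> C / sqrt (real T)))"
proof -
  define xs ys where "xs = fst \<sigma>s" and "ys = snd \<sigma>s"
  define reg1 where "reg1 x y = instant_regret (transformed_loss (payoff1 U) \<mu> (fst \<sigma>r) x y) x" for x y
  define reg2 where "reg2 x y = instant_regret (transformed_loss (payoff2 U) \<mu> (snd \<sigma>r) y x) y" for x y
  define z1 z2 where "z1 = reg1 xs ys" and "z2 = reg2 xs ys"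
  have mem: "xs \<in> prob_simplex" "ys \<in> prob_simplex"
    using assms(3) by (auto simp: xs_def ys_def sccp_saddle_point_def strategy_profiles_def)
  have z_le: "z1 $ i \<le> 0" "z2 $ j \<le> 0" for i j
    using saddle_point_instant_regret_nonpos[OF assms(1,3)]
    by (simp_all add: z1_def z2_def reg1_def reg2_def xs_def ys_def)
  obtain L1 where L1: "0 \<le> L1" "\<And>x y. x \<in> prob_simplex \<Longrightarrow>
      norm (reg1 x y - z1) \<le> L1 * (norm (x - xs) + norm (y - ys))"
    using instant_regret_lipschitz[OF assms(1), of "payoff1 U" "fst \<sigma>r" xs ys]
    unfolding reg1_def z1_def by blast
  obtain L2 where L2: "0 \<le> L2" "\<And>x y. y \<in> prob_simplex \<Longrightarrow>
      norm (reg2 x y - z2) \<le> L2 * (norm (y - ys) + norm (x - xs))"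
    using instant_regret_lipschitz[OF assms(1), of "payoff2 U" "snd \<sigma>r" ys xs]
    unfolding reg2_def z2_def by blast
  define L where "L = max L1 L2"
  define dsq where "dsq x y = (norm (x - xs))\<^sup>2 + (norm (y - ys))\<^sup>2" for x y
  have lip: "norm (reg1 x y - z1) \<le> L * (norm (x - xs) + norm (y - ys))"
      "norm (reg2 x y - z2) \<le> L * (norm (x - xs) + norm (y - ys))"
    if "x \<in> prob_simplex" "y \<in> prob_simplex" for x y
    using order_trans[OF L1(2)[OF that(1), of y] mult_right_mono[of L1 L]]
      order_trans[OF L2(2)[OF that(2), of x] mult_right_mono[of L2 L]]
    by (simp_all add: L_def add.commute)
  have lip_sq: "(norm (reg1 x y - z1))\<^sup>2 \<le> 2 * L\<^sup>2 * dsq x y" "(norm (reg2 x y - z2))\<^sup>2 \<le> 2 * L\<^sup>2 * dsq x y"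
    if "x \<in> prob_simplex" "y \<in> prob_simplex" for x y
  proof -
    have "(norm (x - xs) + norm (y - ys))\<^sup>2 \<le> 2 * dsq x y"
      using sum_squares_bound[of "norm (x - xs)" "norm (y - ys)"]
      by (simp add: dsq_def power2_sum)
    from mult_left_mono[OF this, of "L\<^sup>2"]
    have "(L * (norm (x - xs) + norm (y - ys)))\<^sup>2 \<le> 2 * L\<^sup>2 * dsq x y"
      by (simp add: power_mult_distrib ac_simps)
    with lip[OF that] show "(norm (reg1 x y - z1))\<^sup>2 \<le> 2 * L\<^sup>2 * dsq x y"
        "(norm (reg2 x y - z2))\<^sup>2 \<le> 2 * L\<^sup>2 * dsq x y"
      by (meson norm_ge_zero order_trans power_mono)+
  qed
  \<comment> \<open>The 4 bounds the sum of two distances, each between strategies of norm at most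
    1.\<close>
  define B1 where "B1 = real CARD('a) * (norm z1 + L * 4)"
  define B2 where "B2 = real CARD('b) * (norm z2 + L * 4)"
  have L0: "0 \<le> L" using L1(1) by (simp add: L_def)
  have bound: "l1_norm (reg1 x y) \<le> B1" "l1_norm (reg2 x y) \<le> B2"
    if "x \<in> prob_simplex" "y \<in> prob_simplex" for x y
  proof -
    have "norm (x - xs) + norm (y - ys) \<le> 4"
      using norm_triangle_ineq4[of x xs] norm_triangle_ineq4[of y ys]
        norm_prob_simplex_le[OF that(1)] norm_prob_simplex_le[OF that(2)]
        norm_prob_simplex_le[OF mem(1)] norm_prob_simplex_le[OF mem(2)] by linarith
    then have "L * (norm (x - xs) + norm (y - ys)) \<le> L * 4"
      using L0 by (rule mult_left_mono)
    then have "norm (reg1 x y) \<le> norm z1 + L * 4" "norm (reg2 x y) \<le> norm z2 + L * 4"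
      using lip[OF that] norm_triangle_sub[of "reg1 x y" z1] norm_triangle_sub[of "reg2 x y" z2]
      by linarith+
    then show "l1_norm (reg1 x y) \<le> B1" "l1_norm (reg2 x y) \<le> B2"
      using order_trans[OF l1_norm_le_norm[of "reg1 x y"]] order_trans[OF l1_norm_le_norm[of "reg2 x y"]]
      by (simp_all add: B1_def B2_def mult_left_mono)
  qed
  define M1 where "M1 = l1_norm (pos_part (fst R0)) + B1"
  define M2 where "M2 = l1_norm (pos_part (snd R0)) + B2"
  have l1_nonneg: "0 \<le> l1_norm x" for x :: "real ^ 'k"
    by (simp add: l1_norm_def sum_nonneg)
  \<comment> \<open>The entry 1 gives \<open>lam \<ge> 1\<close>; \<open>M1\<close> and
    \<open>M2\<close> let the comparator term absorb the discount defect;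
    \<open>4 * L\<^sup>2 / \<mu>\<close> lets half of the strong monotonicity pay for the quadratic
    errors of both players.\<close>
  define K where "K = Max {1, M1, M2, 4 * L\<^sup>2 / \<mu>}"
  have K: "1 \<le> K" "M1 \<le> K" "M2 \<le> K" "4 * L\<^sup>2 / \<mu> \<le> K"
    by (simp_all add: K_def)
  \<comment> \<open>For \<open>lam \<ge> 1\<close>, the constant terms of the potential bound are at
    most \<open>lam\<^sup>2 * c1\<close>; see \<open>absorb\<close>.\<close>
  define c1 where "c1 = (norm (pos_part (fst R0)))\<^sup>2 / 2 + \<bar>fst R0 \<bullet> xs\<bar> + \<bar>pos_part (fst R0) \<bullet> z1\<bar> + (norm xs)\<^sup>2 / 2"
  define c2 where "c2 = (norm (pos_part (snd R0)))\<^sup>2 / 2 + \<bar>snd R0 \<bullet> ys\<bar> + \<bar>pos_part (snd R0) \<bullet> z2\<bar> + (norm ys)\<^sup>2 / 2"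
  \<comment> \<open>Solves \<open>\<mu> * A / 4 = (c1 + c2) * K + \<mu> / 4\<close>, which
    contradicts the final inequality; the added 1 makes this strict.\<close>
  define A where "A = 4 * (c1 + c2) * K / \<mu> + 1"
  have "0 \<le> c1" "0 \<le> c2" by (simp_all add: c1_def c2_def)
  then have A: "0 < A" using K(1) assms(1) by (auto simp: A_def intro!: add_nonneg_pos)
  \<comment> \<open>By contradiction: if the first \<open>T\<close> iterates were all far away,
    their weighted total would exceed the potential bound. Iterate \<open>Suc t\<close> stems from
    the regrets after \<open>t\<close> updates.\<close>
  have best: "\<exists>t<T. (norm (\<sigma>s - rtrm_iterate v U \<mu> \<sigma>r R0 (Suc t)))\<^sup>2 \<le> A / real T"
    if v: "admissible_variant v" and T: "1 \<le> T" for v and T :: nat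
  proof (rule ccontr)
    define R where "R = cumulative_regret v U \<mu> \<sigma>r R0"
    define x y where "x t = regret_matching (fst (R t))" and "y t = regret_matching (snd (R t))" for t
    define r1 r2 where "r1 t = reg1 (x t) (y t)" and "r2 t = reg2 (x t) (y t)" for t
    define w where "w = discount_weight v"
    \<comment> \<open>The weights increase, so this dominates \<open>M1 * w t\<close> and
      \<open>M2 * w t\<close> for all \<open>t \<le> T\<close> at once.\<close>
    define lam where "lam = K * w T"
    assume "\<not> ?thesis"
    then have far: "A / real T < dsq (x t) (y t)" if "t < T" for t
      using that
      by (force simp: rtrm_iterate_def rm_profile_def x_def y_def R_def dsq_def xs_def ys_def
          norm_prod_def norm_minus_commute not_le)
    have xy: "x t \<in> prob_simplex" "y t \<in> prob_simplex" for t
      by (simp_all add: x_def y_def regret_matching_in_prob_simplex)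
    have R_Suc: "fst (R (Suc t)) = regret_update v (Suc t) (fst (R t)) (r1 t)"
        "snd (R (Suc t)) = regret_update v (Suc t) (snd (R t)) (r2 t)" for t
      by (simp_all add: R_def rtrm_step_def Let_def rm_profile_def r1_def r2_def reg1_def reg2_def
          x_def y_def)
    have R_0: "R 0 = R0" by (simp add: R_def)
    have orth: "pos_part (fst (R t)) \<bullet> r1 t = 0" "pos_part (snd (R t)) \<bullet> r2 t = 0" for t
      by (simp_all add: r1_def r2_def reg1_def reg2_def x_def y_def pos_part_inner_instant_regret)
    have "l1_norm (pos_part (fst (R t))) \<le> l1_norm (pos_part (fst R0)) + real t * B1"
        "l1_norm (pos_part (snd (R t))) \<le> l1_norm (pos_part (snd R0)) + real t * B2" for t
    proof (induction t)
      case (Suc t)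
      case 1
      show ?case
        using Suc(1) l1_norm_pos_part_regret_update_le[OF v, of "Suc t" "fst (R t)" "r1 t"]
          bound(1)[OF xy, of t t]
        by (simp add: R_Suc r1_def algebra_simps)
      case 2
      show ?case
        using Suc(2) l1_norm_pos_part_regret_update_le[OF v, of "Suc t" "snd (R t)" "r2 t"]
          bound(2)[OF xy, of t t]
        by (simp add: R_Suc r2_def algebra_simps)
    qed (simp_all add: R_0)
    moreover have "l1_norm (pos_part (fst R0)) + real t * B1 \<le> M1 * (real t + 1)"
        "l1_norm (pos_part (snd R0)) + real t * B2 \<le> M2 * (real t + 1)" for t
      using l1_nonneg[of "pos_part (fst R0)"] l1_nonneg[of "pos_part (snd R0)"]
        order_trans[OF l1_nonneg bound(1)[OF mem]] order_trans[OF l1_nonneg bound(2)[OF mem]]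
      by (simp_all add: M1_def M2_def algebra_simps)
    ultimately have M: "l1_norm (pos_part (fst (R t))) \<le> M1 * (real t + 1)"
        "l1_norm (pos_part (snd (R t))) \<le> M2 * (real t + 1)" for t
      using order_trans by blast+
    have w0: "w 0 = 1" by (simp add: w_def discount_weight_def)
    have w_pos: "0 < w t" for t by (simp add: w_def discount_weight_pos[OF v])
    have w_mono: "w t \<le> w T" if "t \<le> T" for t
      using discount_weight_mono[OF v that] by (simp add: w_def)
    have wT: "1 \<le> w T" using w_mono[of 0] by (simp add: w0)
    then have lam: "1 \<le> lam" using K(1) mult_mono[of 1 K 1 "w T"] by (simp add: lam_def)
    define g1 where "g1 t = lam * (r1 t \<bullet> xs) + M1 * w t * (x t \<bullet> z1) - w t * (norm (r1 t - z1))\<^sup>2 / 2" for t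
    define g2 where "g2 t = lam * (r2 t \<bullet> ys) + M2 * w t * (y t \<bullet> z2) - w t * (norm (r2 t - z2))\<^sup>2 / 2" for t
    have absorb: "p / 2 - lam * q - u + lam\<^sup>2 * n / 2 \<le> lam\<^sup>2 * (p / 2 + \<bar>q\<bar> + \<bar>u\<bar> + n / 2)"
      if "0 \<le> p" for p q u n :: real
    proof -
      have l: "1 \<le> lam\<^sup>2" "lam \<le> lam\<^sup>2"
        using lam mult_mono[of 1 lam 1 lam] by (simp_all add: power2_eq_square)
      have "1 * (p / 2) \<le> lam\<^sup>2 * (p / 2)" "lam * \<bar>q\<bar> \<le> lam\<^sup>2 * \<bar>q\<bar>" "1 * \<bar>u\<bar> \<le> lam\<^sup>2 * \<bar>u\<bar>"
        using l that by (intro mult_right_mono; simp)+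
      moreover have "- (lam * q) \<le> lam * \<bar>q\<bar>"
        using lam mult_left_mono[of "- q" "\<bar>q\<bar>" lam] by simp
      ultimately show ?thesis by (simp add: algebra_simps)
    qed
    have "(\<Sum>t<T. w t * g1 t) \<le> lam\<^sup>2 * c1"
    proof -
      have "(\<Sum>t<T. w t * g1 t)
        \<le> (norm (pos_part (fst (R 0))))\<^sup>2 / 2 - lam * (fst (R 0) \<bullet> xs) - pos_part (fst (R 0)) \<bullet> z1
          + lam\<^sup>2 * (norm xs)\<^sup>2 / 2"
        unfolding g1_def x_def
        using lam mem(1)
        by (intro discounted_potential_bound[where a = "pos_discount v" and b = "neg_discount v"])
          (simp_all add: R_Suc regret_update_eq orth discount_bounds[OF v] w0 w_pos M z_le
            discount_weight_Suc[OF v, folded w_def] prob_simplex_def)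
      also have "\<dots> \<le> lam\<^sup>2 * c1"
        unfolding c1_def R_0 by (rule absorb) simp
      finally show ?thesis .
    qed
    moreover have "(\<Sum>t<T. w t * g2 t) \<le> lam\<^sup>2 * c2"
    proof -
      have "(\<Sum>t<T. w t * g2 t)
        \<le> (norm (pos_part (snd (R 0))))\<^sup>2 / 2 - lam * (snd (R 0) \<bullet> ys) - pos_part (snd (R 0)) \<bullet> z2
          + lam\<^sup>2 * (norm ys)\<^sup>2 / 2"
        unfolding g2_def y_def
        using lam mem(2)
        by (intro discounted_potential_bound[where a = "pos_discount v" and b = "neg_discount v"])
          (simp_all add: R_Suc regret_update_eq orth discount_bounds[OF v] w0 w_pos M z_le
            discount_weight_Suc[OF v, folded w_def] prob_simplex_def)
      also have "\<dots> \<le> lam\<^sup>2 * c2"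
        unfolding c2_def R_0 by (rule absorb) simp
      finally show ?thesis .
    qed
    \<comment> \<open>Of the gain \<open>lam * \<mu> * d\<close>, one half pays for the quadratic
      errors and the other half remains.\<close>
    moreover have "(\<Sum>t<T. w t * (lam * \<mu> / 2 * (A / real T))) \<le> (\<Sum>t<T. w t * g1 t) + (\<Sum>t<T. w t * g2 t)"
      unfolding sum.distrib[symmetric] distrib_left[symmetric]
    proof (intro sum_mono mult_left_mono)
      fix t assume "t \<in> {..<T}"
      then have t: "t < T" by simp
      define d where "d = dsq (x t) (y t)"
      have d: "A / real T < d" "0 \<le> d"
        using far[OF t] by (simp_all add: d_def dsq_def)
      have wt: "w t \<le> w T" using w_mono[of t] t by simp
      have nonpos: "x t \<bullet> z1 \<le> 0" "y t \<bullet> z2 \<le> 0"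
        using inner_nonneg_cart[of "x t" "- z1"] inner_nonneg_cart[of "y t" "- z2"] xy[of t] z_le
        by (auto simp: prob_simplex_def)
      \<comment> \<open>As \<open>x t \<bullet> z1\<close> and \<open>y t \<bullet> z2\<close> are
        nonpositive, the defect terms are at least \<open>lam\<close> times these products, which
        cancel in \<open>gain\<close>.\<close>
      have "M1 * w t \<le> lam" "M2 * w t \<le> lam"
        using K wt w_pos[of t] mult_mono[of M1 K "w t" "w T"] mult_mono[of M2 K "w t" "w T"]
        by (simp_all add: lam_def)
      from mult_right_mono_neg[OF this(1) nonpos(1)] mult_right_mono_neg[OF this(2) nonpos(2)]
      have first: "lam * (x t \<bullet> z1) \<le> M1 * w t * (x t \<bullet> z1)" "lam * (y t \<bullet> z2) \<le> M2 * w t * (y t \<bullet> z2)" .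
      have "r1 t \<bullet> xs + r2 t \<bullet> ys = - (x t \<bullet> z1) - y t \<bullet> z2 + \<mu> * d"
        using instant_regret_inner_sum[OF xy(1)[of t] xy(2)[of t] mem]
        by (simp add: r1_def r2_def reg1_def reg2_def z1_def z2_def d_def dsq_def)
      from arg_cong[OF this, of "\<lambda>u. lam * u"]
      have gain: "lam * (r1 t \<bullet> xs) + lam * (r2 t \<bullet> ys)
          = - (lam * (x t \<bullet> z1)) - lam * (y t \<bullet> z2) + lam * \<mu> * d"
        by (simp add: algebra_simps)
      have "w t * (norm (r1 t - z1))\<^sup>2 \<le> w t * (2 * L\<^sup>2 * d)" "w t * (norm (r2 t - z2))\<^sup>2 \<le> w t * (2 * L\<^sup>2 * d)"
        using lip_sq[OF xy, of t t] w_pos[of t]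
        by (simp_all add: r1_def r2_def d_def)
      moreover have "w t * (2 * L\<^sup>2 * d) \<le> lam * \<mu> / 2 * d"
      proof -
        have "w t * (4 * L\<^sup>2) \<le> w T * (K * \<mu>)"
          using K(4) assms(1) wt w_pos[of t] w_pos[of T]
          by (intro mult_mono[of "w t" "w T" "4 * L\<^sup>2"]) (simp_all add: pos_divide_le_eq)
        from mult_right_mono[OF this d(2)] show ?thesis
          by (simp add: lam_def algebra_simps)
      qed
      moreover have "lam * \<mu> / 2 * (A / real T) \<le> lam * \<mu> / 2 * d"
        using d(1) lam assms(1) by (intro mult_left_mono) auto
      moreover have "lam * \<mu> * d = 2 * (lam * \<mu> / 2 * d)" by simp
      ultimately show "lam * \<mu> / 2 * (A / real T) \<le> g1 t + g2 t"
        using first gain unfolding g1_def g2_def by linarith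
    qed (simp add: w_pos less_imp_le)
    ultimately have "(\<Sum>t<T. w t) * (lam * \<mu> / 2 * (A / real T)) \<le> lam\<^sup>2 * (c1 + c2)"
      unfolding sum_distrib_right distrib_left by linarith
    \<comment> \<open>The factor \<open>T\<close> from the total weight cancels the one in
      \<open>A / T\<close>. As \<open>lam\<^sup>2 = lam * w T * K\<close>, dividing by
      \<open>lam * w T\<close> leaves an inequality free of \<open>v\<close> and
      \<open>T\<close>.\<close>
    moreover have "(w T * real T / 2) * (lam * \<mu> / 2 * (A / real T)) \<le> (\<Sum>t<T. w t) * (lam * \<mu> / 2 * (A / real T))"
      using sum_discount_weight_ge[OF v, of T] lam assms(1) A
      by (intro mult_right_mono) (simp_all add: w_def)
    moreover have "(w T * real T / 2) * (lam * \<mu> / 2 * (A / real T)) = lam * w T * (\<mu> * A / 4)"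
      using T by simp
    ultimately have "lam * w T * (\<mu> * A / 4) \<le> lam\<^sup>2 * (c1 + c2)"
      by linarith
    also have "lam\<^sup>2 * (c1 + c2) = lam * w T * ((c1 + c2) * K)"
      by (simp add: lam_def power2_eq_square)
    finally have "lam * w T * (\<mu> * A / 4) \<le> lam * w T * ((c1 + c2) * K)" .
    moreover have "\<mu> * A / 4 = (c1 + c2) * K + \<mu> / 4"
      using assms(1) by (simp add: A_def field_simps)
    moreover have "0 < lam * w T" using lam w_pos[of T] by simp
    ultimately have "\<mu> / 4 \<le> 0"
      using mult_le_cancel_left_pos[of "lam * w T" "(c1 + c2) * K + \<mu> / 4" "(c1 + c2) * K"] by auto
    then show False using assms(1) by simp
  qed
  show ?thesis
  \<comment> \<open>\<open>A\<close> was fixed before \<open>v\<close> and \<open>T\<close>, so one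
    constant serves all variants and horizons.\<close>
  proof (intro exI[of _ "sqrt A"] conjI allI impI)
    fix v and T :: nat
    assume "admissible_variant v" and T: "1 \<le> T"
    then obtain t where t: "t < T" "(norm (\<sigma>s - rtrm_iterate v U \<mu> \<sigma>r R0 (Suc t)))\<^sup>2 \<le> A / real T"
      using best by blast
    have "norm (\<sigma>s - rtrm_iterate v U \<mu> \<sigma>r R0 (Suc t)) \<le> sqrt A / sqrt (real T)"
      using real_le_rsqrt[OF t(2)] by (simp add: real_sqrt_divide)
    with t(1) show "\<exists>t. 0 < t \<and> t \<le> T \<and> norm (\<sigma>s - rtrm_iterate v U \<mu> \<sigma>r R0 t) \<le> sqrt A / sqrt (real T)"
      by (intro exI[of _ "Suc t"]) simp
  qed (simp add: A)
qed

end
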